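(* Let $n\ge1$, let $\alpha_1,\dots,\alpha_n\in\mathbb{C}$, let $\lambda>1$ be real, and set $$F(z)=\prod_{i=1}^n(z-\alpha_i),\qquad F_\lambda(z)=\prod_{i=1}^n\left(z-\frac{\alpha_i}{\lambda}\right).$$ (1) If $\max_i|\alpha_i|<\sqrt\lambda$, then the factorizations $F_\lambda(z)=B_1(z)\cdot G_\lambda(z)$ (the $1$-Blaschke factorization of $F_\lambda$) and $F(z)=B_{\sqrt\lambda}(z)\cdot G(z)$ (the $\sqrt\lambda$-Blaschke factorization of $F$) satisfy $$\sqrt{\lambda^n}\cdot G_\lambda(z)=G(z).$$ (2) Without any assumption on the norms of the roots $\alpha_i$, the factorizations $F_\lambda(z)=B_1(z)\cdot G_\lambda(z)$ (the $1$-Blaschke factorization of $F_\lambda$) and $F(z)=B_\lambda(z)\cdot G(z)$ (the $\lambda$-Blaschke factorization of $F$) satisfy $$\lambda^n\cdot G_\lambda(z)=G(\lambda z).$$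
   Context: $r$-Blaschke factorization: for $r>0$ and a nonzero polynomial $P$, let $$B_r(z)=\prod_i\frac{(z-\beta_i)\,r}{r^2-\overline{\beta_i}z},$$ the product being over the roots $\beta_i$ of $P$, counted with multiplicity, with $|\beta_i|<r$. The $r$-Blaschke factorization of $P$ is $P=B_r\cdot G$; here $G=P/B_r$ is the polynomial obtained from $P$ by replacing each factor $z-\beta_i$ with $|\beta_i|<r$ by $\frac1r(r^2-\overline{\beta_i}z)$. The case $r=1$ is the canonical Blaschke factorization. The symbols $B_1,B_{\sqrt\lambda},B_\lambda$ denote the products associated with the polynomial being factored. *)

theory Defs
  imports "HOL-Analysis.Analysis" "HOL-Computational_Algebra.Computational_Algebra"
begin

text \<open>Roots are taken from \<^const>\<open>proots\<close>, so they are repeated according to multiplicity.\<close>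

definition blaschke_product :: "real \<Rightarrow> complex poly \<Rightarrow> complex \<Rightarrow> complex" where
  "blaschke_product r P z =
     (\<Prod>\<beta>\<in>#filter_mset (\<lambda>\<beta>. norm \<beta> < r) (proots P).
        ((z - \<beta>) * of_real r) / ((of_real r)\<^sup>2 - cnj \<beta> * z))"

text \<open>
  The poles of the Blaschke product are excluded, since division by zero yields zero in HOL.
  Being a polynomial, the cofactor is determined by its values away from these
  finitely many points.
\<close>

definition blaschke_factorization :: "real \<Rightarrow> complex poly \<Rightarrow> complex poly \<Rightarrow> bool" where
  "blaschke_factorization r P G \<longleftrightarrow>
     (\<forall>z. (\<forall>\<beta>\<in>#proots P. norm \<beta> < r \<longrightarrow> (of_real r)\<^sup>2 - cnj \<beta> * z \<noteq> 0) \<longrightarrow>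
          poly P z = blaschke_product r P z * poly G z)"

text \<open>
  The cofactor exists, is unique, and is obtained from \<open>P\<close> by replacing each factor
  \<open>z - \<beta>\<close> with \<open>\<bar>\<beta>\<bar> < r\<close> by \<open>(r\<^sup>2 - cnj \<beta> * z) / r\<close>.
\<close>

definition blaschke_cofactor :: "real \<Rightarrow> complex poly \<Rightarrow> complex poly" where
  "blaschke_cofactor r P = smult (lead_coeff P)
     (\<Prod>\<beta>\<in>#proots P. if norm \<beta> < r then [:of_real r, - (cnj \<beta> / of_real r):] else [:- \<beta>, 1:])"

lemma blaschke_factorization_cofactor:
  assumes "r > 0"
  shows "blaschke_factorization r P (blaschke_cofactor r P)"
  unfolding blaschke_factorization_def
proof (intro allI impI)
  fix z :: complex
  assume nz: "\<forall>\<beta>\<in>#proots P. norm \<beta> < r \<longrightarrow> (of_real r)\<^sup>2 - cnj \<beta> * z \<noteq> 0"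
  define h :: "complex \<Rightarrow> complex poly" where
    "h = (\<lambda>\<beta>. if norm \<beta> < r then [:of_real r, - (cnj \<beta> / of_real r):] else [:- \<beta>, 1:])"
  define b :: "complex \<Rightarrow> complex" where
    "b = (\<lambda>\<beta>. ((z - \<beta>) * of_real r) / ((of_real r)\<^sup>2 - cnj \<beta> * z))"
  have "(\<Prod>\<beta>\<in>#M. poly [:- \<beta>, 1:] z) =
      (\<Prod>\<beta>\<in>#filter_mset (\<lambda>\<beta>. norm \<beta> < r) M. b \<beta>) * (\<Prod>\<beta>\<in>#M. poly (h \<beta>) z)"
    if "\<forall>\<beta>\<in>#M. norm \<beta> < r \<longrightarrow> (of_real r)\<^sup>2 - cnj \<beta> * z \<noteq> 0" for M
    using that
  proof (induction M)
    case (add x M)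
    have x: "poly [:- x, 1:] z = (if norm x < r then b x else 1) * poly (h x) z"
    proof (cases "norm x < r")
      case True
      then have ne: "(of_real r)\<^sup>2 - cnj x * z \<noteq> 0"
        using add.prems by simp
      have "poly (h x) z = ((of_real r)\<^sup>2 - cnj x * z) / of_real r"
        using assms True by (simp add: h_def field_simps power2_eq_square)
      then show ?thesis
        using True ne assms by (simp add: b_def)
    qed (simp add: h_def)
    have IH: "(\<Prod>\<beta>\<in>#M. poly [:- \<beta>, 1:] z) =
        (\<Prod>\<beta>\<in>#filter_mset (\<lambda>\<beta>. norm \<beta> < r) M. b \<beta>) * (\<Prod>\<beta>\<in>#M. poly (h \<beta>) z)"
      using add by simp
    show ?case
      by (simp only: image_mset_add_mset prod_mset.add_mset x IH) (simp add: mult_ac)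
  qed simp
  from this[OF nz]
  have eq: "(\<Prod>\<beta>\<in>#proots P. poly [:- \<beta>, 1:] z) =
      blaschke_product r P z * (\<Prod>\<beta>\<in>#proots P. poly (h \<beta>) z)"
    by (simp add: blaschke_product_def b_def)
  have pm: "poly (\<Prod>\<beta>\<in>#M. f \<beta>) z = (\<Prod>\<beta>\<in>#M. poly (f \<beta>) z)"
    for f :: "complex \<Rightarrow> complex poly" and M
    by (induction M) auto
  have "poly P z = poly (smult (lead_coeff P) (\<Prod>\<beta>\<in>#proots P. [:- \<beta>, 1:])) z"
    by (simp only: complex_poly_decompose_multiset)
  also have "\<dots> = lead_coeff P * (\<Prod>\<beta>\<in>#proots P. poly [:- \<beta>, 1:] z)"
    by (simp only: poly_smult pm)
  also have "\<dots> = blaschke_product r P z * poly (blaschke_cofactor r P) z"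
    unfolding eq blaschke_cofactor_def poly_smult pm h_def by (simp add: mult_ac)
  finally show "poly P z = blaschke_product r P z * poly (blaschke_cofactor r P) z" .
qed

lemma blaschke_factorization_unique:
  assumes "r > 0" "P \<noteq> 0" "blaschke_factorization r P G" "blaschke_factorization r P H"
  shows "G = H"
proof -
  define Z where "Z = (\<Union>\<beta>\<in>set_mset (proots P). {z. norm \<beta> < r \<and> (of_real r)\<^sup>2 - cnj \<beta> * z = 0})"
  have "finite {z. norm \<beta> < r \<and> (of_real r)\<^sup>2 - cnj \<beta> * z = 0}" for \<beta>
  proof (rule finite_subset)
    show "{z. norm \<beta> < r \<and> (of_real r)\<^sup>2 - cnj \<beta> * z = 0} \<subseteq> {(of_real r)\<^sup>2 / cnj \<beta>}"
      using assms(1) by (auto simp: field_simps)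
  qed simp
  then have Z: "finite (Z \<union> {z. poly P z = 0})"
    using assms(2) by (auto simp: Z_def poly_roots_finite)
  have "poly (G - H) z = 0" if "z \<notin> Z \<union> {z. poly P z = 0}" for z
  proof -
    have "poly P z = blaschke_product r P z * poly G z" "poly P z = blaschke_product r P z * poly H z"
      using assms(3,4) that by (auto simp: blaschke_factorization_def Z_def)
    with that show ?thesis by auto
  qed
  then have "- (Z \<union> {z. poly P z = 0}) \<subseteq> {z. poly (G - H) z = 0}"
    by auto
  moreover have "infinite (- (Z \<union> {z. poly P z = 0}))"
    using Z by (simp only: Compl_eq_Diff_UNIV) (rule Diff_infinite_finite, auto simp: infinite_UNIV_char_0)
  ultimately have "infinite {z. poly (G - H) z = 0}"
    using finite_subset by blast
  then have "G - H = 0"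
    using poly_roots_finite by blast
  then show ?thesis by simp
qed

lemma blaschke_factorization_iff:
  assumes "r > 0" "P \<noteq> 0"
  shows "blaschke_factorization r P G \<longleftrightarrow> G = blaschke_cofactor r P"
  using assms blaschke_factorization_cofactor blaschke_factorization_unique by blast

end

theory Submission
  imports Defs
begin

text \<open>
  The cofactor of a monic product of linear factors is itself a product, one factor per root:
  a root \<open>a\<close> contributes \<open>r - cnj a / r * z\<close> if \<open>\<bar>a\<bar> < r\<close> and \<open>z - a\<close> otherwise. Since the cofactor
  is the only polynomial that completes a Blaschke factorization, both identities may be checked
  factor by factor, with the \<open>n\<close>-th power of the scalar spread over the \<open>n\<close> factors.

  In both parts the reflected roots on the two sides correspond. If \<open>\<bar>a\<bar> < sqrt lam\<close>, then \<open>a\<close> is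
  reflected in the circle of radius \<open>sqrt lam\<close>, and \<open>a / lam\<close>, having modulus below 1, is reflected
  in the unit circle; the reflections of the two are the same point \<open>lam / cnj a\<close> (infinity if
  \<open>a = 0\<close>), and the factors differ by \<open>sqrt lam\<close>. For the radius \<open>lam\<close>, the scaling
  \<open>z \<mapsto> lam * z\<close> carries the unit circle to the circle of radius \<open>lam\<close> and \<open>a / lam\<close> to \<open>a\<close>, so
  it commutes with reflection, and each factor, reflected or not, scales by \<open>lam\<close>.
\<close>

lemma proots_prod_linear_factors:
  fixes a :: "'i \<Rightarrow> 'a::idom"
  assumes "finite A"
  shows "proots (\<Prod>i\<in>A. [:- a i, 1:]) = image_mset a (mset_set A)"
  using assms
proof (induction A rule: finite_induct)
  case (insert x A)
  have "(\<Prod>i\<in>A. [:- a i, 1:]) \<noteq> 0"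
    using insert.hyps by simp
  then show ?case
    using insert by (simp add: proots_mult del: mult_pCons_left)
qed simp

lemma poly_blaschke_cofactor_prod_linear_factors:
  assumes "finite A"
  shows "poly (blaschke_cofactor r (\<Prod>i\<in>A. [:- a i, 1:])) z =
    (\<Prod>i\<in>A. if norm (a i) < r then of_real r - cnj (a i) / of_real r * z else z - a i)"
proof -
  have "lead_coeff (\<Prod>i\<in>A. [:- a i, 1:]) = 1"
    by (simp add: lead_coeff_prod)
  moreover have "(\<Prod>\<beta>\<in>#image_mset a (mset_set A). h \<beta>) = (\<Prod>i\<in>A. h (a i))"
    for h :: "complex \<Rightarrow> complex poly"
    by (simp add: prod_unfold_prod_mset multiset.map_comp comp_def)
  ultimately show ?thesis
    unfolding blaschke_cofactor_def proots_prod_linear_factors[OF assms]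
    by (auto simp: poly_prod mult.commute intro!: prod.cong)
qed

theorem proposition2p1:
  fixes n :: nat and \<alpha> :: "nat \<Rightarrow> complex" and lam :: real and F F_lam :: "complex poly"
  assumes "n \<ge> 1" and "lam > 1"
    and "F = (\<Prod>i=1..n. [:- \<alpha> i, 1:])"
    and "F_lam = (\<Prod>i=1..n. [:- (\<alpha> i / of_real lam), 1:])"
  shows "((MAX i\<in>{1..n}. norm (\<alpha> i)) < sqrt lam \<longrightarrow>
      (\<forall>G G_lam. blaschke_factorization 1 F_lam G_lam \<and> blaschke_factorization (sqrt lam) F G \<longrightarrow>
         (\<forall>z. of_real (sqrt (lam ^ n)) * poly G_lam z = poly G z))) \<and>
    (\<forall>G G_lam. blaschke_factorization 1 F_lam G_lam \<and> blaschke_factorization lam F G \<longrightarrow>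
         (\<forall>z. of_real (lam ^ n) * poly G_lam z = poly G (of_real lam * z)))"
proof -
  have nz: "F \<noteq> 0" "F_lam \<noteq> 0"
    unfolding assms(3,4) by simp_all
  have lam: "lam > 0" "sqrt lam > 0"
    using assms(2) by simp_all
  have G_value: "poly G z = (\<Prod>i=1..n. if norm (\<alpha> i) < r
        then of_real r - cnj (\<alpha> i) / of_real r * z else z - \<alpha> i)"
    if "blaschke_factorization r F G" "r > 0" for r G z
    using that nz unfolding assms(3)
    by (simp add: blaschke_factorization_iff poly_blaschke_cofactor_prod_linear_factors)
  have G_lam_value: "poly G z = (\<Prod>i=1..n. if norm (\<alpha> i) < lam
        then 1 - cnj (\<alpha> i) / of_real lam * z else z - \<alpha> i / of_real lam)"
    if "blaschke_factorization 1 F_lam G" for G z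
    using that nz lam unfolding assms(4)
    by (auto simp: blaschke_factorization_iff poly_blaschke_cofactor_prod_linear_factors
        norm_divide intro!: prod.cong)
  show ?thesis
  proof (intro conjI impI allI; elim conjE)
    fix G G_lam z
    assume small: "(MAX i\<in>{1..n}. norm (\<alpha> i)) < sqrt lam"
      and fac: "blaschke_factorization 1 F_lam G_lam" "blaschke_factorization (sqrt lam) F G"
    have small_i: "norm (\<alpha> i) < sqrt lam" if "i \<in> {1..n}" for i
      using small that assms(1) by (subst (asm) Max_less_iff) auto
    \<comment> \<open>As \<open>lam > 1\<close>, the bound also puts every root \<open>\<alpha> i / lam\<close> of \<open>F_lam\<close> in the open unit disc,
      so on both sides all factors are reflected.\<close>
    have "sqrt lam < lam"
      using assms(2) by (simp add: real_less_lsqrt power2_eq_square)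
    then have less_lam: "norm (\<alpha> i) < lam" if "i \<in> {1..n}" for i
      using small_i[OF that] by simp
    define s where "s = sqrt lam"
    have s: "s > 0" "lam = s * s"
      using lam by (simp_all add: s_def)
    have "of_real (sqrt (lam ^ n)) * poly G_lam z
        = (\<Prod>i=1..n. of_real s * (1 - cnj (\<alpha> i) / of_real lam * z))"
      using less_lam by (simp add: G_lam_value[OF fac(1)] prod.distrib real_sqrt_power s_def)
    also have "\<dots> = poly G z"
      unfolding G_value[OF fac(2) lam(2)]
      using small_i s(1) by (intro prod.cong) (auto simp: s_def[symmetric] s(2) field_simps)
    finally show "of_real (sqrt (lam ^ n)) * poly G_lam z = poly G z" .
  next
    fix G G_lam z
    assume fac: "blaschke_factorization 1 F_lam G_lam" "blaschke_factorization lam F G"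
    have "of_real (lam ^ n) * poly G_lam z
        = (\<Prod>i=1..n. of_real lam * (if norm (\<alpha> i) < lam
            then 1 - cnj (\<alpha> i) / of_real lam * z else z - \<alpha> i / of_real lam))"
      by (simp add: G_lam_value[OF fac(1)] prod.distrib)
    also have "\<dots> = poly G (of_real lam * z)"
      unfolding G_value[OF fac(2) lam(1)]
      using lam by (intro prod.cong) (auto simp: field_simps)
    finally show "of_real (lam ^ n) * poly G_lam z = poly G (of_real lam * z)" .
  qed
qed

end
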